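(* Let $\mathcal{A}$ be a real symmetric tensor of order $m$ and dimension $n$. If $\mathcal{A}$ is an almost semi-positive tensor (almost $\mathbf{E_0}$-tensor), then $\mathcal{A}$ has a negative $H^{++}$-eigenvalue. If $\mathcal{A}$ is an almost strictly semi-positive tensor (almost $\mathbf{E}$-tensor), then $\mathcal{A}$ has a nonpositive $H^{++}$-eigenvalue.
   Context: A real tensor of order $m$ ($m\ge 2$) and dimension $n$ is an array $\mathcal{A}=(a_{i_1\ldots i_m})$ with $a_{i_1\ldots i_m}\in\mathbb{R}$, $i_1,\ldots,i_m\in I_n=\{1,\ldots,n\}$. It is symmetric if its entries are invariant under all permutations of their indices. For $\mathbf{x}\in\mathbb{R}^n$, $\mathcal{A}\mathbf{x}^{m-1}\in\mathbb{R}^n$ is defined by $(\mathcal{A}\mathbf{x}^{m-1})_i=\sum_{i_2,\ldots,i_m=1}^n a_{i i_2\ldots i_m}x_{i_2}\cdots x_{i_m}$. Vector inequalities are componentwise. For nonempty $J\subseteq I_n$, the principal subtensor of $\mathcal{A}$ indexed by $J$ is the tensor of order $m$ and dimension $|J|$ with entries $a_{i_1\ldots i_m}$, $i_1,\ldots,i_m\in J$; it is proper if $J\neq I_n$. $\mathcal{A}$ is semi-positive ($\mathbf{E_0}$-tensor), respectively strictly semi-positive ($\mathbf{E}$-tensor), if for each $\mathbf{x}\ge\mathbf{0}$, $\mathbf{x}\ne\mathbf{0}$, there is $k\in I_n$ with $x_k>0$ and $(\mathcal{A}\mathbf{x}^{m-1})_k\ge 0$, respectively $(\mathcal{A}\mathbf{x}^{m-1})_k>0$.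 $\mathcal{A}$ is almost semi-positive (almost $\mathbf{E_0}$-tensor) if every proper principal subtensor of $\mathcal{A}$ is semi-positive and there is $\mathbf{x}>\mathbf{0}$ with $\mathcal{A}\mathbf{x}^{m-1}<\mathbf{0}$. $\mathcal{A}$ is almost strictly semi-positive (almost $\mathbf{E}$-tensor) if every proper principal subtensor of $\mathcal{A}$ is strictly semi-positive and there is $\mathbf{x}>\mathbf{0}$ with $\mathcal{A}\mathbf{x}^{m-1}\le\mathbf{0}$. An $H^{++}$-eigenvalue of $\mathcal{A}$ is a real number $\lambda$ for which there is a real vector $\mathbf{x}>\mathbf{0}$ in $\mathbb{R}^n$ with $\mathcal{A}\mathbf{x}^{m-1}=\lambda\mathbf{x}^{[m-1]}$, where $\mathbf{x}^{[m-1]}=(x_1^{m-1},\ldots,x_n^{m-1})^T$. *)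

theory Defs
  imports "HOL-Analysis.Analysis"
begin

text \<open>
  A tensor of order \<open>m\<close> over a finite index set \<open>I\<close> (its dimension is \<open>card I\<close>) is represented by a
  function on index lists; only its values on lists of length \<open>m\<close> with entries in \<open>I\<close> matter.
  Likewise a vector over \<open>I\<close> is a function of which only the values on \<open>I\<close> matter. The index set is
  an explicit parameter because principal subtensors have a smaller dimension than the tensor itself.
\<close>

definition tensor_indices :: "nat \<Rightarrow> 'i set \<Rightarrow> 'i list set" where
  "tensor_indices m I = {is. length is = m \<and> set is \<subseteq> I}"

definition symmetric_tensor :: "nat \<Rightarrow> 'i set \<Rightarrow> ('i list \<Rightarrow> real) \<Rightarrow> bool" where
  "symmetric_tensor m I A \<longleftrightarrow>
     (\<forall>is\<in>tensor_indices m I. \<forall>p. p permutes {..<m} \<longrightarrow> A (permute_list p is) = A is)"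

text \<open>The \<open>i\<close>-th component of \<open>A x\<close>\<open>\<^sup>m\<^sup>-\<^sup>1\<close>; the list \<open>js\<close> collects the indices \<open>i\<^sub>2, \<dots>, i\<^sub>m\<close>.\<close>

definition tensor_apply :: "nat \<Rightarrow> 'i set \<Rightarrow> ('i list \<Rightarrow> real) \<Rightarrow> ('i \<Rightarrow> real) \<Rightarrow> 'i \<Rightarrow> real" where
  "tensor_apply m I A x i =
     (\<Sum>js\<in>tensor_indices (m - 1) I. A (i # js) * prod_list (map x js))"

text \<open>The principal subtensor keeps the labels in \<open>J\<close> instead of renumbering them; it is a tensor
  over the index set \<open>J\<close>.\<close>

definition principal_subtensor :: "nat \<Rightarrow> 'i set \<Rightarrow> ('i list \<Rightarrow> real) \<Rightarrow> ('i list \<Rightarrow> real)" where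
  "principal_subtensor m J A = restrict A (tensor_indices m J)"

definition semi_positive :: "nat \<Rightarrow> 'i set \<Rightarrow> ('i list \<Rightarrow> real) \<Rightarrow> bool" where
  "semi_positive m I A \<longleftrightarrow>
     (\<forall>x. (\<forall>i\<in>I. 0 \<le> x i) \<and> (\<exists>i\<in>I. x i \<noteq> 0) \<longrightarrow>
          (\<exists>k\<in>I. 0 < x k \<and> 0 \<le> tensor_apply m I A x k))"

definition strictly_semi_positive :: "nat \<Rightarrow> 'i set \<Rightarrow> ('i list \<Rightarrow> real) \<Rightarrow> bool" where
  "strictly_semi_positive m I A \<longleftrightarrow>
     (\<forall>x. (\<forall>i\<in>I. 0 \<le> x i) \<and> (\<exists>i\<in>I. x i \<noteq> 0) \<longrightarrow>
          (\<exists>k\<in>I. 0 < x k \<and> 0 < tensor_apply m I A x k))"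

definition almost_semi_positive :: "nat \<Rightarrow> 'i set \<Rightarrow> ('i list \<Rightarrow> real) \<Rightarrow> bool" where
  "almost_semi_positive m I A \<longleftrightarrow>
     (\<forall>J. J \<noteq> {} \<and> J \<subset> I \<longrightarrow> semi_positive m J (principal_subtensor m J A)) \<and>
     (\<exists>x. (\<forall>i\<in>I. 0 < x i) \<and> (\<forall>i\<in>I. tensor_apply m I A x i < 0))"

definition almost_strictly_semi_positive :: "nat \<Rightarrow> 'i set \<Rightarrow> ('i list \<Rightarrow> real) \<Rightarrow> bool" where
  "almost_strictly_semi_positive m I A \<longleftrightarrow>
     (\<forall>J. J \<noteq> {} \<and> J \<subset> I \<longrightarrow> strictly_semi_positive m J (principal_subtensor m J A)) \<and>
     (\<exists>x. (\<forall>i\<in>I. 0 < x i) \<and> (\<forall>i\<in>I. tensor_apply m I A x i \<le> 0))"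

text \<open>\<open>Hpp\<close> stands for \<open>H\<close>\<open>\<^sup>+\<^sup>+\<close>.\<close>

definition Hpp_eigenvalue :: "nat \<Rightarrow> 'i set \<Rightarrow> ('i list \<Rightarrow> real) \<Rightarrow> real \<Rightarrow> bool" where
  "Hpp_eigenvalue m I A l \<longleftrightarrow>
     (\<exists>x. (\<forall>i\<in>I. 0 < x i) \<and> (\<forall>i\<in>I. tensor_apply m I A x i = l * x i ^ (m - 1)))"

end

theory Submission
  imports Defs
begin

text \<open>
  The eigenvector is a minimiser of the form \<open>f(x) = A x\<^sup>m\<close> over the compact set of all
  \<open>x \<ge> 0\<close> with \<open>\<Sum>x\<^sub>i\<^sup>m = 1\<close>, and the eigenvalue is the minimum \<open>l\<close>
  (\<open>tensor_form_minimiser_exists\<close>). By homogeneity, \<open>f(y) - l \<Sum>y\<^sub>i\<^sup>m \<ge> 0\<close> on the whole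
  nonnegative orthant, with equality at the minimiser \<open>x\<close>. Symmetry of \<open>A\<close> gives
  \<open>\<partial>f/\<partial>x\<^sub>i = m (A x\<^sup>m\<^sup>-\<^sup>1)\<^sub>i\<close> (\<open>DERIV_tensor_form\<close>), and along a coordinate \<open>i\<close> with
  \<open>x\<^sub>i > 0\<close> the minimum is an interior one, so \<open>(A x\<^sup>m\<^sup>-\<^sup>1)\<^sub>i = l x\<^sub>i\<^sup>m\<^sup>-\<^sup>1\<close>
  for every \<open>i\<close> in the support \<open>J\<close> of \<open>x\<close> (\<open>tensor_apply_minimiser\<close>).

  Evaluating \<open>f(y) = \<Sum>y\<^sub>i (A y\<^sup>m\<^sup>-\<^sup>1)\<^sub>i\<close> at the positive vector provided by the hypothesis shows \<open>l < 0\<close> in the almost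
  semi-positive case and \<open>l \<le> 0\<close> in the almost strictly semi-positive case. If \<open>J\<close> were a proper
  subset of the index set, then \<open>x\<close> restricted to \<open>J\<close> would be a positive vector that the principal
  subtensor indexed by \<open>J\<close> maps to a negative, respectively nonpositive, one, so this subtensor
  would not be semi-positive, respectively strictly semi-positive. Hence \<open>x > 0\<close>.
\<close>

section \<open>The homogeneous form of a tensor\<close>

lemma tensor_indices_Suc:
  "tensor_indices (Suc k) I = (\<lambda>(i, js). i # js) ` (I \<times> tensor_indices k I)"
proof (intro equalityI subsetI)
  fix "is" assume "is \<in> tensor_indices (Suc k) I"
  then show "is \<in> (\<lambda>(i, js). i # js) ` (I \<times> tensor_indices k I)"
    by (cases "is") (auto simp: tensor_indices_def)
qed (auto simp: tensor_indices_def)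

lemma finite_tensor_indices: "finite I \<Longrightarrow> finite (tensor_indices m I)"
  unfolding tensor_indices_def using finite_lists_length_eq[of I m] by (simp add: conj_commute)

lemma sum_tensor_indices_Suc:
  "(\<Sum>is\<in>tensor_indices (Suc k) I. g is) = (\<Sum>i\<in>I. \<Sum>js\<in>tensor_indices k I. g (i # js))"
  unfolding tensor_indices_Suc
  by (subst sum.reindex) (auto simp: inj_on_def sum.cartesian_product split_def)

text \<open>The homogeneous form \<open>A x\<^sup>m\<close>, written as the sum of all \<open>a\<^bsub>i\<^sub>1\<dots>i\<^sub>m\<^esub> x\<^bsub>i\<^sub>1\<^esub> \<cdots> x\<^bsub>i\<^sub>m\<^esub>\<close>.\<close>

definition tensor_form :: "nat \<Rightarrow> 'i set \<Rightarrow> ('i list \<Rightarrow> real) \<Rightarrow> ('i \<Rightarrow> real) \<Rightarrow> real" where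
  "tensor_form m I A x = (\<Sum>is\<in>tensor_indices m I. A is * prod_list (map x is))"

lemma tensor_form_eq_sum_tensor_apply:
  assumes "m \<ge> 1"
  shows "tensor_form m I A x = (\<Sum>i\<in>I. x i * tensor_apply m I A x i)"
proof -
  obtain k where "m = Suc k" using assms by (cases m) auto
  then show ?thesis
    by (simp add: tensor_form_def sum_tensor_indices_Suc tensor_apply_def sum_distrib_left mult_ac)
qed

lemma tensor_form_cong:
  assumes "\<And>i. i \<in> I \<Longrightarrow> x i = y i"
  shows "tensor_form m I A x = tensor_form m I A y"
  unfolding tensor_form_def
proof (rule sum.cong[OF refl])
  fix "is" assume "is \<in> tensor_indices m I"
  then have "map x is = map y is" using assms by (auto simp: tensor_indices_def)
  then show "A is * prod_list (map x is) = A is * prod_list (map y is)" by (simp only:)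
qed

lemma prod_list_map_scale:
  fixes c :: "'a :: comm_monoid_mult"
  shows "prod_list (map (\<lambda>i. c * x i) xs) = c ^ length xs * prod_list (map x xs)"
  by (induction xs) (simp_all add: mult_ac)

lemma tensor_form_scale: "tensor_form m I A (\<lambda>i. c * x i) = c ^ m * tensor_form m I A x"
  unfolding tensor_form_def sum_distrib_left
  by (rule sum.cong) (auto simp: prod_list_map_scale tensor_indices_def)

lemma continuous_on_tensor_form: "continuous_on S (tensor_form m I A)"
proof -
  have "continuous_on S (\<lambda>x :: 'a \<Rightarrow> real. prod_list (map x is))" for "is"
    by (induction "is")
      (auto intro!: continuous_on_mult continuous_on_subset[OF continuous_on_product_coordinates])
  then show ?thesis
    unfolding tensor_form_def[abs_def] by (intro continuous_intros)
qed

section \<open>Partial derivatives of the form\<close>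

lemma prod_list_map_nth: "prod_list (map x xs) = (\<Prod>k<length xs. x (xs ! k))"
  by (simp add: prod.list_conv_set_nth lessThan_atLeast0)

text \<open>
  By symmetry, the sum of the terms in which the \<open>k\<close>-th factor has been differentiated does not
  depend on \<open>k\<close>; for \<open>k = 0\<close> it is \<open>(A x\<^sup>m\<^sup>-\<^sup>1)\<^sub>i\<close>.
\<close>

lemma sum_differentiated_factor:
  assumes "symmetric_tensor m I A" "finite I" "i \<in> I" "k < m"
  shows "(\<Sum>is\<in>tensor_indices m I.
            A is * ((if is ! k = i then 1 else 0) * (\<Prod>l\<in>{..<m} - {k}. x (is ! l))))
         = tensor_apply m I A x i" (is "sum (?g k) _ = _")
proof -
  let ?p = "Transposition.transpose 0 k"
  have p: "?p permutes {..<m}" using assms(4) by (intro permutes_swap_id) auto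
  have "sum (?g k) (tensor_indices m I) = sum (?g 0) (tensor_indices m I)"
  proof (rule sum.reindex_bij_witness[of _ "permute_list ?p" "permute_list ?p"])
    fix "is" assume is_in: "is \<in> tensor_indices m I"
    then have len: "length is = m" and sub: "set is \<subseteq> I" by (auto simp: tensor_indices_def)
    show inv: "permute_list ?p (permute_list ?p is) = is"
      using permute_list_compose[of ?p "is" ?p] p len by simp
    then show "permute_list ?p (permute_list ?p is) = is" .
    show mem: "permute_list ?p is \<in> tensor_indices m I"
      using len sub p by (simp add: tensor_indices_def)
    then show "permute_list ?p is \<in> tensor_indices m I" .
    have nth: "permute_list ?p is ! l = is ! ?p l" if "l < m" for l
      using permute_list_nth p len that by metis
    have A_eq: "A (permute_list ?p is) = A is"
      using assms(1) is_in p by (simp add: symmetric_tensor_def)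
    have "(\<Prod>l\<in>{..<m} - {0}. x (permute_list ?p is ! l)) = (\<Prod>l\<in>{..<m} - {0}. x (is ! ?p l))"
      by (rule prod.cong) (auto simp: nth)
    also have "\<dots> = (\<Prod>l\<in>{..<m} - {k}. x (is ! l))"
    proof (rule prod.reindex_bij_witness[of _ ?p ?p])
      fix l
      show "l \<in> {..<m} - {0} \<Longrightarrow> ?p l \<in> {..<m} - {k}"
        using assms(4) by (auto simp: Transposition.transpose_def)
      show "l \<in> {..<m} - {k} \<Longrightarrow> ?p l \<in> {..<m} - {0}"
        using assms(4) by (auto simp: Transposition.transpose_def)
    qed auto
    finally show "?g 0 (permute_list ?p is) = ?g k is"
      using A_eq nth[of 0] assms(4) by simp
  qed
  also have "\<dots> = tensor_apply m I A x i"
  proof -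
    obtain r where m: "m = Suc r" using assms(4) by (cases m) auto
    have shift: "(\<Prod>l\<in>{..<m} - {0}. x ((j # js) ! l)) = prod_list (map x js)"
      if "js \<in> tensor_indices r I" for j js
    proof -
      have "{..<m} - {0} = Suc ` {..<r}"
        unfolding m by (auto simp: lessThan_Suc_eq_insert_0)
      then have "(\<Prod>l\<in>{..<m} - {0}. x ((j # js) ! l)) = (\<Prod>l<r. x (js ! l))"
        by (simp add: prod.reindex)
      also have "\<dots> = prod_list (map x js)"
        using that by (simp add: prod_list_map_nth tensor_indices_def)
      finally show ?thesis .
    qed
    have "sum (?g 0) (tensor_indices m I) =
        (\<Sum>j\<in>I. \<Sum>js\<in>tensor_indices r I. ?g 0 (j # js))"
      unfolding m by (rule sum_tensor_indices_Suc)
    also have "\<dots> = (\<Sum>j\<in>I. if j = i then \<Sum>js\<in>tensor_indices r I. A (i # js) * prod_list (map x js)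
        else 0)"
    proof (rule sum.cong[OF refl])
      fix j
      have "(\<Sum>js\<in>tensor_indices r I. ?g 0 (j # js)) = (\<Sum>js\<in>tensor_indices r I.
          A (j # js) * ((if j = i then 1 else 0) * prod_list (map x js)))"
        by (intro sum.cong refl) (simp only: shift nth_Cons_0)
      then show "(\<Sum>js\<in>tensor_indices r I. ?g 0 (j # js)) =
          (if j = i then \<Sum>js\<in>tensor_indices r I. A (i # js) * prod_list (map x js) else 0)"
        by simp
    qed
    also have "\<dots> = tensor_apply m I A x i"
      using assms(2,3) by (simp add: tensor_apply_def m)
    finally show ?thesis .
  qed
  finally show ?thesis .
qed

lemma DERIV_tensor_form:
  assumes "symmetric_tensor m I A" "finite I" "i \<in> I"
  shows "((\<lambda>t. tensor_form m I A (x(i := t))) has_real_derivative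
            real m * tensor_apply m I A x i) (at (x i))"
proof -
  let ?D = "\<lambda>is k. (if is ! k = i then 1 else 0) * (\<Prod>l\<in>{..<m} - {k}. x (is ! l))"
  have factor: "((\<lambda>t. (x(i := t)) j) has_real_derivative (if j = i then 1 else 0)) (at (x i))" for j
    by auto
  have "((\<lambda>t. prod_list (map (x(i := t)) is)) has_real_derivative (\<Sum>k<m. ?D is k)) (at (x i))"
    if "is \<in> tensor_indices m I" for "is"
  proof -
    have "((\<lambda>t. \<Prod>k<m. (x(i := t)) (is ! k)) has_real_derivative
        (\<Sum>k<m. (if is ! k = i then 1 else 0) * (\<Prod>l\<in>{..<m} - {k}. (x(i := x i)) (is ! l)))) (at (x i))"
      by (intro has_field_derivative_prod factor)
    moreover have "prod_list (map y is) = (\<Prod>k<m. y (is ! k))" for y :: "'a \<Rightarrow> real"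
      using that by (simp add: prod_list_map_nth tensor_indices_def)
    ultimately show ?thesis by simp
  qed
  then have "((\<lambda>t. tensor_form m I A (x(i := t))) has_real_derivative
      (\<Sum>is\<in>tensor_indices m I. A is * (\<Sum>k<m. ?D is k))) (at (x i))"
    unfolding tensor_form_def by (intro DERIV_sum DERIV_cmult)
  also have "(\<Sum>is\<in>tensor_indices m I. A is * (\<Sum>k<m. ?D is k)) =
      (\<Sum>k<m. \<Sum>is\<in>tensor_indices m I. A is * ?D is k)"
    unfolding sum_distrib_left by (rule sum.swap)
  also have "\<dots> = (\<Sum>k<m. tensor_apply m I A x i)"
    using assms by (intro sum.cong sum_differentiated_factor) auto
  finally show ?thesis by (simp del: fun_upd_apply)
qed

lemma DERIV_sum_powers:
  fixes x :: "'i \<Rightarrow> real"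
  assumes "finite I" "i \<in> I"
  shows "((\<lambda>t. \<Sum>j\<in>I. (x(i := t)) j ^ m) has_real_derivative
            real m * x i ^ (m - 1)) (at (x i))"
proof -
  have "((\<lambda>t. (x(i := t)) j ^ m) has_real_derivative
      (if j = i then real m * x i ^ (m - 1) else 0)) (at (x i))" for j
    by (auto intro!: derivative_eq_intros)
  then have "((\<lambda>t. \<Sum>j\<in>I. (x(i := t)) j ^ m) has_real_derivative
      (\<Sum>j\<in>I. if j = i then real m * x i ^ (m - 1) else 0)) (at (x i))"
    by (intro DERIV_sum)
  then show ?thesis using assms by simp
qed

section \<open>Minimisation over the nonnegative orthant\<close>

text \<open>
  The first-order condition at a coordinate \<open>x\<^sub>i > 0\<close>. No multiplier rule is needed: homogeneity has
  turned the constrained minimum into the unconstrained bound \<open>lower\<close> on the orthant.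
\<close>

lemma tensor_apply_minimiser:
  assumes "symmetric_tensor m I A" "finite I" "m \<ge> 1"
    and lower: "\<And>y. (\<forall>i\<in>I. 0 \<le> y i) \<Longrightarrow> l * (\<Sum>i\<in>I. y i ^ m) \<le> tensor_form m I A y"
    and nonneg: "\<forall>i\<in>I. 0 \<le> x i"
    and attained: "tensor_form m I A x = l * (\<Sum>i\<in>I. x i ^ m)"
    and i: "i \<in> I" "0 < x i"
  shows "tensor_apply m I A x i = l * x i ^ (m - 1)"
proof -
  let ?g = "\<lambda>t. tensor_form m I A (x(i := t)) - l * (\<Sum>j\<in>I. (x(i := t)) j ^ m)"
  have "(?g has_real_derivative
      real m * tensor_apply m I A x i - l * (real m * x i ^ (m - 1))) (at (x i))"
    using assms by (intro DERIV_diff DERIV_cmult DERIV_tensor_form DERIV_sum_powers)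
  moreover have "\<forall>t. \<bar>x i - t\<bar> < x i \<longrightarrow> ?g (x i) \<le> ?g t"
  proof (intro allI impI)
    \<comment> \<open>The radius \<open>x i\<close> keeps the perturbed coordinate positive.\<close>
    fix t assume "\<bar>x i - t\<bar> < x i"
    then have "\<forall>j\<in>I. 0 \<le> (x(i := t)) j" using nonneg by auto
    from lower[OF this] show "?g (x i) \<le> ?g t"
      using attained by (simp del: fun_upd_apply)
  qed
  ultimately have "real m * tensor_apply m I A x i - l * (real m * x i ^ (m - 1)) = 0"
    using i(2) by (intro DERIV_local_min)
  then have "real m * tensor_apply m I A x i = real m * (l * x i ^ (m - 1))"
    by (simp add: mult_ac)
  then show ?thesis using assms(3) by simp
qed

text \<open>
  Vectors over \<open>I\<close> are functions on the whole type, with the product topology; fixing them to be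
  \<open>0\<close> outside \<open>I\<close> is what makes the set compact.
\<close>

lemma compact_power_sphere_orthant:
  assumes "finite I" "m \<ge> 1"
  shows "compact {x :: 'i \<Rightarrow> real. (\<forall>i\<in>I. 0 \<le> x i) \<and> (\<forall>i. i \<notin> I \<longrightarrow> x i = 0) \<and> (\<Sum>i\<in>I. x i ^ m) = 1}"
proof -
  let ?S = "{x :: 'i \<Rightarrow> real. (\<forall>i\<in>I. 0 \<le> x i) \<and> (\<forall>i. i \<notin> I \<longrightarrow> x i = 0) \<and> (\<Sum>i\<in>I. x i ^ m) = 1}"
  let ?box = "PiE UNIV (\<lambda>i. if i \<in> I then {0..1 :: real} else {0})"
  let ?sphere = "{x :: 'i \<Rightarrow> real. (\<Sum>i\<in>I. x i ^ m) = 1}"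
  have "compactin (product_topology (\<lambda>i::'i. euclidean) UNIV) ?box"
    by (subst compactin_PiE) auto
  then have "compact ?box"
    by (simp add: euclidean_product_topology)
  moreover have "closed ?sphere"
    by (intro closed_Collect_eq continuous_intros) auto
  ultimately have "compact (?box \<inter> ?sphere)" by (rule compact_Int_closed)
  also have "?box \<inter> ?sphere = ?S"
  proof (intro equalityI subsetI)
    fix x assume x: "x \<in> ?box \<inter> ?sphere"
    then have "x i \<in> (if i \<in> I then {0..1} else {0})" for i by blast
    then have "(i \<in> I \<longrightarrow> 0 \<le> x i) \<and> (i \<notin> I \<longrightarrow> x i = 0)" for i
      by (metis atLeastAtMost_iff singletonD)
    with x show "x \<in> ?S" by blast
  next
    fix x assume x: "x \<in> ?S"
    have "x i \<le> 1" if "i \<in> I" for i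
    proof -
      have "x i ^ m \<le> (\<Sum>j\<in>I. x j ^ m)"
        using x assms(1) that by (intro member_le_sum) auto
      then have "x i ^ m \<le> 1 ^ m" using x by simp
      then show ?thesis using assms(2) x that by (subst (asm) power_mono_iff) auto
    qed
    then show "x \<in> ?box \<inter> ?sphere" using x by (auto simp: PiE_iff)
  qed
  finally show ?thesis .
qed

lemma tensor_form_minimiser_exists:
  fixes A :: "'i list \<Rightarrow> real"
  assumes "finite I" "I \<noteq> {}" "m \<ge> 1"
  obtains l x where "\<forall>i\<in>I. 0 \<le> x i" "\<exists>i\<in>I. x i \<noteq> 0"
    "tensor_form m I A x = l * (\<Sum>i\<in>I. x i ^ m)"
    "\<And>y. (\<forall>i\<in>I. 0 \<le> y i) \<Longrightarrow> l * (\<Sum>i\<in>I. y i ^ m) \<le> tensor_form m I A y"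
proof -
  define S :: "('i \<Rightarrow> real) set" where
    "S = {x. (\<forall>i\<in>I. 0 \<le> x i) \<and> (\<forall>i. i \<notin> I \<longrightarrow> x i = 0) \<and> (\<Sum>i\<in>I. x i ^ m) = 1}"
  have "compact S"
    unfolding S_def using assms by (intro compact_power_sphere_orthant)
  moreover have "S \<noteq> {}"
  proof -
    obtain i where i: "i \<in> I" using assms(2) by auto
    have "(\<Sum>j\<in>I. (if j = i then 1 else 0 :: real) ^ m) = (\<Sum>j\<in>I. if j = i then 1 else 0)"
      using assms(3) by (intro sum.cong) auto
    then have "(\<lambda>j. if j = i then 1 else 0) \<in> S"
      using i assms(1) by (auto simp: S_def)
    then show ?thesis by auto
  qed
  ultimately obtain x where x: "x \<in> S"
    and min: "\<And>y. y \<in> S \<Longrightarrow> tensor_form m I A x \<le> tensor_form m I A y"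
    using continuous_attains_inf[OF _ _ continuous_on_tensor_form] by metis
  define l where "l = tensor_form m I A x"
  have lower: "l * (\<Sum>i\<in>I. y i ^ m) \<le> tensor_form m I A y" if y: "\<forall>i\<in>I. 0 \<le> y i" for y
  proof (cases "\<forall>i\<in>I. y i = 0")
    case True
    then have "tensor_form m I A y = 0"
      using assms(3) by (simp add: tensor_form_eq_sum_tensor_apply)
    then show ?thesis using True assms(3) by (auto simp: power_0_left)
  next
    case False
    define s where "s = (\<Sum>i\<in>I. y i ^ m)"
    obtain i where i: "i \<in> I" "y i \<noteq> 0" using False by auto
    have "0 < y i" using i y by force
    then have "0 < y i ^ m" by simp
    also have "\<dots> \<le> s"
      unfolding s_def using i y assms(1) by (intro member_le_sum) auto
    finally have s: "0 < s" .
    \<comment> \<open>Rescale \<open>y\<close> onto the constraint set and compare there.\<close>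
    define c where "c = 1 / root m s"
    have c: "0 \<le> c" "c ^ m = 1 / s"
      using s assms(3) by (auto simp: c_def power_divide)
    let ?z = "\<lambda>i. if i \<in> I then c * y i else 0"
    have "(\<Sum>i\<in>I. ?z i ^ m) = c ^ m * s"
      by (simp add: s_def power_mult_distrib sum_distrib_left)
    then have "?z \<in> S" using y c s by (auto simp: S_def)
    then have "l \<le> tensor_form m I A ?z" unfolding l_def by (rule min)
    also have "\<dots> = tensor_form m I A (\<lambda>i. c * y i)" by (rule tensor_form_cong) simp
    also have "\<dots> = tensor_form m I A y / s" by (simp add: tensor_form_scale c)
    finally show ?thesis using s by (simp add: s_def field_simps)
  qed
  have "\<exists>i\<in>I. x i \<noteq> 0"
  proof (rule ccontr)
    assume "\<not> (\<exists>i\<in>I. x i \<noteq> 0)"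
    then have "(\<Sum>i\<in>I. x i ^ m) = 0" using assms(3) by simp
    then show False using x by (simp add: S_def)
  qed
  with x lower show ?thesis
    by (intro that[of x l]) (auto simp: S_def l_def)
qed

section \<open>Principal subtensors and eigenvalues\<close>

lemma tensor_apply_principal_subtensor:
  assumes "finite I" "J \<subseteq> I" "\<And>i. i \<in> I - J \<Longrightarrow> x i = 0" "i \<in> J" "m \<ge> 1"
  shows "tensor_apply m J (principal_subtensor m J A) x i = tensor_apply m I A x i"
proof -
  have "tensor_apply m J (principal_subtensor m J A) x i =
      (\<Sum>js\<in>tensor_indices (m - 1) J. A (i # js) * prod_list (map x js))"
    unfolding tensor_apply_def principal_subtensor_def
    using assms(4,5) by (intro sum.cong) (auto simp: tensor_indices_def)
  also have "\<dots> = tensor_apply m I A x i"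
    unfolding tensor_apply_def
  proof (rule sum.mono_neutral_left)
    show "finite (tensor_indices (m - 1) I)" using assms(1) by (rule finite_tensor_indices)
    show "tensor_indices (m - 1) J \<subseteq> tensor_indices (m - 1) I"
      using assms(2) by (auto simp: tensor_indices_def)
    show "\<forall>js\<in>tensor_indices (m - 1) I - tensor_indices (m - 1) J.
        A (i # js) * prod_list (map x js) = 0"
    proof
      fix js assume "js \<in> tensor_indices (m - 1) I - tensor_indices (m - 1) J"
      then obtain j where "j \<in> set js" "j \<in> I - J" by (auto simp: tensor_indices_def)
      then have "0 \<in> set (map x js)" using assms(3) by force
      then show "A (i # js) * prod_list (map x js) = 0" by (simp add: prod_list_zero_iff)
    qed
  qed
  finally show ?thesis .
qed

text \<open>
  Combination of the preceding lemmas: \<open>l\<close> is the minimum of the form, \<open>J\<close> the support of the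
  minimiser. A positive vector on which \<open>A\<close> is nonpositive or negative bounds the sign of \<open>l\<close>.
  If \<open>J = I\<close>, then \<open>l\<close> is an \<open>H\<^sup>+\<^sup>+\<close>-eigenvalue; otherwise the last conclusion will contradict
  the (strict) semi-positivity of the principal subtensor indexed by \<open>J\<close>.
\<close>

lemma symmetric_tensor_minimum_eigenpair:
  assumes "symmetric_tensor m I A" "finite I" "I \<noteq> {}" "m \<ge> 1"
  obtains l x J where "J \<noteq> {}" "J \<subseteq> I" "\<And>i. i \<in> J \<Longrightarrow> 0 < x i"
    "\<And>y. \<forall>i\<in>I. 0 < y i \<Longrightarrow> \<forall>i\<in>I. tensor_apply m I A y i \<le> 0 \<Longrightarrow> l \<le> 0"
    "\<And>y. \<forall>i\<in>I. 0 < y i \<Longrightarrow> \<forall>i\<in>I. tensor_apply m I A y i < 0 \<Longrightarrow> l < 0"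
    "J = I \<Longrightarrow> Hpp_eigenvalue m I A l"
    "\<And>i. i \<in> J \<Longrightarrow> tensor_apply m J (principal_subtensor m J A) x i = l * x i ^ (m - 1)"
proof -
  obtain l x where x: "\<forall>i\<in>I. 0 \<le> x i" "\<exists>i\<in>I. x i \<noteq> 0"
    and attained: "tensor_form m I A x = l * (\<Sum>i\<in>I. x i ^ m)"
    and lower: "\<And>y. (\<forall>i\<in>I. 0 \<le> y i) \<Longrightarrow> l * (\<Sum>i\<in>I. y i ^ m) \<le> tensor_form m I A y"
    using tensor_form_minimiser_exists[OF assms(2-4)] by metis
  define J where "J = {i \<in> I. 0 < x i}"
  have J_sub: "J \<subseteq> I" by (auto simp: J_def)
  have eigen: "tensor_apply m I A x i = l * x i ^ (m - 1)" if "i \<in> J" for i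
    using that tensor_apply_minimiser[OF assms(1,2,4) lower x(1) attained] by (auto simp: J_def)
  have form: "tensor_form m I A y = (\<Sum>i\<in>I. y i * tensor_apply m I A y i)" for y
    using assms(4) by (rule tensor_form_eq_sum_tensor_apply)
  have pos: "0 < (\<Sum>i\<in>I. y i ^ m)" if "\<forall>i\<in>I. 0 < y i" for y :: "'a \<Rightarrow> real"
    using that assms(2,3) by (intro sum_pos) auto
  have outside: "x i = 0" if "i \<in> I - J" for i
    using x(1) that by (force simp: J_def)
  show ?thesis
  proof (rule that)
    show "J \<noteq> {}" "J \<subseteq> I" "\<And>i. i \<in> J \<Longrightarrow> 0 < x i"
      using x by (auto simp: J_def order_less_le)
  next
    fix y assume y: "\<forall>i\<in>I. 0 < y i" "\<forall>i\<in>I. tensor_apply m I A y i \<le> 0"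
    have "l * (\<Sum>i\<in>I. y i ^ m) \<le> tensor_form m I A y" using y by (intro lower) auto
    also have "\<dots> \<le> 0" unfolding form using y by (intro sum_nonpos mult_nonneg_nonpos) auto
    finally show "l \<le> 0" using pos[OF y(1)] by (simp add: mult_le_0_iff)
  next
    fix y assume y: "\<forall>i\<in>I. 0 < y i" "\<forall>i\<in>I. tensor_apply m I A y i < 0"
    have "l * (\<Sum>i\<in>I. y i ^ m) \<le> tensor_form m I A y" using y by (intro lower) auto
    also have "\<dots> < (\<Sum>i\<in>I. 0)"
      unfolding form using y assms(2,3) by (intro sum_strict_mono) (auto intro: mult_pos_neg)
    finally show "l < 0" using pos[OF y(1)] by (simp add: mult_less_0_iff)
  next
    assume "J = I"
    then show "Hpp_eigenvalue m I A l"
      using eigen by (auto simp: Hpp_eigenvalue_def J_def)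
  next
    fix i assume "i \<in> J"
    then show "tensor_apply m J (principal_subtensor m J A) x i = l * x i ^ (m - 1)"
      using tensor_apply_principal_subtensor[OF assms(2) J_sub outside _ assms(4)] eigen
      by simp
  qed
qed

lemma almost_semi_positive_negative_eigenvalue:
  assumes "symmetric_tensor m I A" "finite I" "I \<noteq> {}" "m \<ge> 1" "almost_semi_positive m I A"
  shows "\<exists>l<0. Hpp_eigenvalue m I A l"
proof -
  from assms(1-4) obtain l x J where J: "J \<noteq> {}" "J \<subseteq> I" and x: "\<And>i. i \<in> J \<Longrightarrow> 0 < x i"
    and neg: "\<And>y. \<forall>i\<in>I. 0 < y i \<Longrightarrow> \<forall>i\<in>I. tensor_apply m I A y i < 0 \<Longrightarrow> l < 0"
    and eigenvalue: "J = I \<Longrightarrow> Hpp_eigenvalue m I A l"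
    and sub: "\<And>i. i \<in> J \<Longrightarrow> tensor_apply m J (principal_subtensor m J A) x i = l * x i ^ (m - 1)"
    by (rule symmetric_tensor_minimum_eigenpair) blast
  have l: "l < 0" using assms(5) neg by (auto simp: almost_semi_positive_def)
  have "J = I"
  proof (rule ccontr)
    assume "J \<noteq> I"
    then have "semi_positive m J (principal_subtensor m J A)"
      using J assms(5) by (auto simp: almost_semi_positive_def)
    moreover have "(\<forall>i\<in>J. 0 \<le> x i) \<and> (\<exists>i\<in>J. x i \<noteq> 0)"
      using x J(1) by (metis all_not_in_conv less_imp_le less_irrefl)
    ultimately obtain k where "k \<in> J" "0 \<le> tensor_apply m J (principal_subtensor m J A) x k"
      unfolding semi_positive_def by blast
    then have "0 \<le> l * x k ^ (m - 1)" by (simp only: sub)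
    moreover have "l * x k ^ (m - 1) < 0" using \<open>k \<in> J\<close> x l by (simp add: mult_neg_pos)
    ultimately show False by simp
  qed
  with l eigenvalue show ?thesis by auto
qed

lemma almost_strictly_semi_positive_nonpositive_eigenvalue:
  assumes "symmetric_tensor m I A" "finite I" "I \<noteq> {}" "m \<ge> 1"
    "almost_strictly_semi_positive m I A"
  shows "\<exists>l\<le>0. Hpp_eigenvalue m I A l"
proof -
  from assms(1-4) obtain l x J where J: "J \<noteq> {}" "J \<subseteq> I" and x: "\<And>i. i \<in> J \<Longrightarrow> 0 < x i"
    and nonpos: "\<And>y. \<forall>i\<in>I. 0 < y i \<Longrightarrow> \<forall>i\<in>I. tensor_apply m I A y i \<le> 0 \<Longrightarrow> l \<le> 0"
    and eigenvalue: "J = I \<Longrightarrow> Hpp_eigenvalue m I A l"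
    and sub: "\<And>i. i \<in> J \<Longrightarrow> tensor_apply m J (principal_subtensor m J A) x i = l * x i ^ (m - 1)"
    by (rule symmetric_tensor_minimum_eigenpair) blast
  have l: "l \<le> 0" using assms(5) nonpos by (auto simp: almost_strictly_semi_positive_def)
  have "J = I"
  proof (rule ccontr)
    assume "J \<noteq> I"
    then have "strictly_semi_positive m J (principal_subtensor m J A)"
      using J assms(5) by (auto simp: almost_strictly_semi_positive_def)
    moreover have "(\<forall>i\<in>J. 0 \<le> x i) \<and> (\<exists>i\<in>J. x i \<noteq> 0)"
      using x J(1) by (metis all_not_in_conv less_imp_le less_irrefl)
    ultimately obtain k where "k \<in> J" "0 < tensor_apply m J (principal_subtensor m J A) x k"
      unfolding strictly_semi_positive_def by blast
    then have "0 < l * x k ^ (m - 1)" by (simp only: sub)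
    moreover have "l * x k ^ (m - 1) \<le> 0"
      using \<open>k \<in> J\<close> x[of k] l by (simp add: mult_nonpos_nonneg)
    ultimately show False by simp
  qed
  with l eigenvalue show ?thesis by auto
qed

theorem theorem16:
  fixes m n :: nat and A :: "nat list \<Rightarrow> real"
  assumes "m \<ge> 2" and "n \<ge> 1"
    and "symmetric_tensor m {1..n} A"
  shows "(almost_semi_positive m {1..n} A \<longrightarrow>
            (\<exists>l<0. Hpp_eigenvalue m {1..n} A l)) \<and>
         (almost_strictly_semi_positive m {1..n} A \<longrightarrow>
            (\<exists>l\<le>0. Hpp_eigenvalue m {1..n} A l))"
  using almost_semi_positive_negative_eigenvalue[OF assms(3)]
    almost_strictly_semi_positive_nonpositive_eigenvalue[OF assms(3)] assms(1,2)
  by simp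

end
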